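(* Let $n\ge 0$ be an integer. The map $\sigma$ is a bijection between $\mathcal{T}_n$ (the set of colored $5$-ary trees for which $4$ times the number of internal vertices plus the sum of all color numbers equals $n$) and $\mathcal{CB}'_n$ (the set of proper colored binary trees with $n$ internal vertices).
   Context: Binary trees. A complete binary tree is a rooted plane tree in which every internal vertex has exactly two children, a left child and a right child; the other vertices are leaves, and the single-leaf tree has $0$ internal vertices. A path $P=v_0v_1\cdots v_k$ of length $k\ge 0$ in a complete binary tree (going away from the root, and possibly ending at a leaf) is an L-path if $v_i$ is the left child of $v_{i-1}$ for all $1\le i\le k$. It is a maximal L-path if there is no vertex $u$ such that $uP$ or $Pu$ is an L-path. The first vertex $v_0$ of a maximal L-path is called an initial vertex, and $l(v_0)=k$ denotes the length (number of edges) of that path. Thus the initial vertices are exactly the root and all right children, including leaves that are right children, for which $l=0$. A colored binary tree is a complete binary tree in which each initial vertex $v$ is assigned an integer color $c(v)$ with $0\le c(v)\le\lfloor l(v)/2\rfloor$. It is proper if for every initial vertex $v$ there is an integer $k\ge 0$ with $c(v)=2k$ and $l(v)\in\{4k,4k+1\}$. $\mathcal{CB}'_n$ is the set of proper colored binary trees with $n$ internal vertices. In a proper tree each color is forced, $c(v)=\lfloor l(v)/2\rfloor$, so the colors are discarded and the elements of $\mathcal{CB}'_n$ are regarded as the uncolored complete binary trees with $n$ internal vertices in which $l(v)\equiv 0$ or $1 \pmod 4$ for every initial vertex $v$. $5$-ary trees. A $5$-ary tree is a rooted ordered tree in which each internal vertex has exactly $5$ (ordered) children; the single-leaf tree has $0$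 internal vertices. A colored $5$-ary tree is a $5$-ary tree in which each vertex $v$ (internal vertex or leaf) is assigned a nonnegative integer $c_v$, its color number. For $0\le p\le\lfloor n/4\rfloor$, $\mathcal{T}_{n,p}$ is the set of colored $5$-ary trees with $p$ internal vertices such that the sum of all color numbers is $n-4p$, and $\mathcal{T}_n=\bigcup_{p=0}^{\lfloor n/4\rfloor}\mathcal{T}_{n,p}$. The map $\sigma$. Given $T\in\mathcal{T}_n$, the tree $\sigma(T)$ is obtained by two steps. Step 1. For each vertex $v$ of $T$ with color number $c_v=k$, remove the color number and insert above $v$ a path $v_1v_2\cdots v_k$ of new vertices: $v_1$ takes the place of $v$ as a child of the father of $v$ (or as the root, if $v$ is the root), $v_{i+1}$ is the right child of $v_i$ for $1\le i<k$, $v$ is the right child of $v_k$, and the left child of each $v_i$ ($1\le i\le k$) is a new leaf. (If $k=0$ nothing is inserted.) Let $T^*$ be the resulting tree. Step 2. For each internal vertex $v$ of $T^*$ that has $5$ children, with subtrees $T_1,T_2,T_3,T_4,T_5$ from left to right, replace the children of $v$ as follows, using new vertices $v_1,v_2,v_3$: $v_1$ is the left child of $v$, $v_2$ is the left child of $v_1$, and $v_3$ is the left child of $v_2$; $T_1$ and $T_2$ are the left and right subtrees of $v_3$, $T_3$ is the right subtree of $v_2$, $T_4$ is the right subtree of $v_1$, and $T_5$ is the right subtree of $v$. The resulting complete binary tree is $\sigma(T)$. *)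

theory Defs
  imports Main "HOL-Library.FuncSet"
begin

section \<open>Complete binary trees\<close>

datatype btree = Leaf | Node btree btree

fun internal :: "btree \<Rightarrow> nat" where
  "internal Leaf = 0"
| "internal (Node l r) = Suc (internal l + internal r)"

text \<open>A vertex is represented by its address, the sequence of left/right turns leading to it
  from the root; the left child of a vertex \<open>u\<close> is thus \<open>u @ [Lft]\<close>.\<close>

datatype dir = Lft | Rgt

type_synonym vertex = "dir list"

fun vertices :: "btree \<Rightarrow> vertex set" where
  "vertices Leaf = {[]}"
| "vertices (Node l r) = {[]} \<union> (#) Lft ` vertices l \<union> (#) Rgt ` vertices r"

definition L_path :: "btree \<Rightarrow> vertex list \<Rightarrow> bool" where
  "L_path t P \<longleftrightarrow> P \<noteq> [] \<and> set P \<subseteq> vertices t \<and>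
     (\<forall>i. 1 \<le> i \<and> i < length P \<longrightarrow> P ! i = P ! (i - 1) @ [Lft])"

definition maximal_L_path :: "btree \<Rightarrow> vertex list \<Rightarrow> bool" where
  "maximal_L_path t P \<longleftrightarrow>
     L_path t P \<and> \<not> (\<exists>u \<in> vertices t. L_path t (u # P) \<or> L_path t (P @ [u]))"

definition initial_vertices :: "btree \<Rightarrow> vertex set" where
  "initial_vertices t = {hd P | P. maximal_L_path t P}"

text \<open>For an initial vertex \<open>v\<close> the maximal L-path starting at \<open>v\<close> is unique; its length is
  counted in edges. The value for other vertices is irrelevant.\<close>

definition L_length :: "btree \<Rightarrow> vertex \<Rightarrow> nat" where
  "L_length t v = (THE k. \<exists>P. maximal_L_path t P \<and> hd P = v \<and> length P = Suc k)"

text \<open>Colorings are made \<^const>\<open>undefined\<close> outside the initial vertices, so that each colored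
  tree has exactly one representation.\<close>

definition colored_btrees :: "(btree \<times> (vertex \<Rightarrow> nat)) set" where
  "colored_btrees = {(t, c). c \<in> (\<Pi>\<^sub>E v \<in> initial_vertices t. {0..L_length t v div 2})}"

definition proper :: "btree \<times> (vertex \<Rightarrow> nat) \<Rightarrow> bool" where
  "proper = (\<lambda>(t, c). \<forall>v \<in> initial_vertices t.
     \<exists>k. c v = 2 * k \<and> L_length t v \<in> {4 * k, 4 * k + 1})"

text \<open>The colors of a proper colored tree are discarded.\<close>

definition proper_btrees :: "nat \<Rightarrow> btree set" where
  "proper_btrees n = fst ` {tc \<in> colored_btrees. proper tc \<and> internal (fst tc) = n}"

text \<open>No information is lost by discarding colors, and the resulting uncolored trees are those
  in which every maximal L-path has length congruent to 0 or 1 modulo 4.\<close>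

lemma inj_on_discard_colors: "inj_on fst {tc \<in> colored_btrees. proper tc}"
proof (rule inj_onI, clarsimp)
  fix t c d
  assume *: "(t, c) \<in> colored_btrees" "proper (t, c)" "(t, d) \<in> colored_btrees" "proper (t, d)"
  have "c v = d v" if "v \<in> initial_vertices t" for v
    using *(2,4) that unfolding proper_def by fastforce
  with *(1,3) show "c = d"
    unfolding colored_btrees_def by (auto intro: PiE_ext)
qed

lemma proper_btrees_eq:
  "proper_btrees n =
     {t. internal t = n \<and> (\<forall>v \<in> initial_vertices t. L_length t v mod 4 \<in> {0, 1})}"
proof (intro equalityI subsetI)
  fix t assume "t \<in> proper_btrees n"
  then show "t \<in> {t. internal t = n \<and> (\<forall>v \<in> initial_vertices t. L_length t v mod 4 \<in> {0, 1})}"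
    unfolding proper_btrees_def proper_def by fastforce
next
  fix t
  assume t: "t \<in> {t. internal t = n \<and> (\<forall>v \<in> initial_vertices t. L_length t v mod 4 \<in> {0, 1})}"
  define c where "c = (\<lambda>v \<in> initial_vertices t. L_length t v div 2)"
  have "(t, c) \<in> colored_btrees"
    unfolding colored_btrees_def c_def by auto
  moreover have "proper (t, c)"
    unfolding proper_def prod.case
  proof
    fix v assume v: "v \<in> initial_vertices t"
    with t have "L_length t v mod 4 = 0 \<or> L_length t v mod 4 = 1" by auto
    then have "L_length t v div 2 = 2 * (L_length t v div 4)"
      "L_length t v = 4 * (L_length t v div 4) \<or> L_length t v = 4 * (L_length t v div 4) + 1"
      by presburger+
    with v show "\<exists>k. c v = 2 * k \<and> L_length t v \<in> {4 * k, 4 * k + 1}"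
      unfolding c_def by auto
  qed
  ultimately show "t \<in> proper_btrees n"
    using t unfolding proper_btrees_def by force
qed

section \<open>Colored 5-ary trees\<close>

text \<open>The natural number argument of each constructor is the color number of the vertex.\<close>

datatype qtree = QLeaf nat | QNode nat qtree qtree qtree qtree qtree

fun q_internal :: "qtree \<Rightarrow> nat" where
  "q_internal (QLeaf c) = 0"
| "q_internal (QNode c t1 t2 t3 t4 t5) =
     Suc (q_internal t1 + q_internal t2 + q_internal t3 + q_internal t4 + q_internal t5)"

fun color_sum :: "qtree \<Rightarrow> nat" where
  "color_sum (QLeaf c) = c"
| "color_sum (QNode c t1 t2 t3 t4 t5) =
     c + color_sum t1 + color_sum t2 + color_sum t3 + color_sum t4 + color_sum t5"

definition colored_qtrees_with :: "nat \<Rightarrow> nat \<Rightarrow> qtree set" where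
  "colored_qtrees_with n p = {T. q_internal T = p \<and> color_sum T = n - 4 * p}"

definition colored_qtrees :: "nat \<Rightarrow> qtree set" where
  "colored_qtrees n = (\<Union>p \<in> {0..n div 4}. colored_qtrees_with n p)"

section \<open>The map sigma\<close>

text \<open>Intermediate trees, whose internal vertices have two or five children.\<close>

datatype mtree = MLeaf | MBin mtree mtree | MQuin mtree mtree mtree mtree mtree

text \<open>\<open>insert_path k T\<close> puts a path of \<open>k\<close> new vertices above the root of \<open>T\<close>, each
  with a leaf as left child and the next vertex (finally the root of \<open>T\<close>) as right child.\<close>

definition insert_path :: "nat \<Rightarrow> mtree \<Rightarrow> mtree" where
  "insert_path k T = (MBin MLeaf ^^ k) T"

fun sigma_step1 :: "qtree \<Rightarrow> mtree" where
  "sigma_step1 (QLeaf c) = insert_path c MLeaf"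
| "sigma_step1 (QNode c t1 t2 t3 t4 t5) =
     insert_path c (MQuin (sigma_step1 t1) (sigma_step1 t2) (sigma_step1 t3)
                          (sigma_step1 t4) (sigma_step1 t5))"

fun sigma_step2 :: "mtree \<Rightarrow> btree" where
  "sigma_step2 MLeaf = Leaf"
| "sigma_step2 (MBin l r) = Node (sigma_step2 l) (sigma_step2 r)"
| "sigma_step2 (MQuin t1 t2 t3 t4 t5) =
     Node (Node (Node (Node (sigma_step2 t1) (sigma_step2 t2)) (sigma_step2 t3))
       (sigma_step2 t4)) (sigma_step2 t5)"

definition sigma :: "qtree \<Rightarrow> btree" where
  "sigma T = sigma_step2 (sigma_step1 T)"

end

theory Submission
  imports Defs
begin

text \<open>Reading off the root of \<open>sigma T\<close>: a single leaf means color \<open>0\<close> on a leaf, a left leaf below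
  an internal root means a positive root color, and a left spine of length at least \<open>2\<close>, hence at
  least \<open>4\<close> in a proper tree, means a root with five children and color \<open>0\<close>. Removing the four
  vertices of step 2 shortens a left spine by \<open>4\<close> and so preserves its length modulo \<open>4\<close>; recursion
  on the remaining subtrees inverts \<open>sigma\<close>.\<close>

section \<open>Maximal L-paths\<close>

fun left_spine :: "btree \<Rightarrow> nat" where
  "left_spine Leaf = 0"
| "left_spine (Node l r) = Suc (left_spine l)"

text \<open>A recursive stand-in for \<open>L_length\<close>, which is given by a definite
  description. The value \<open>0\<close> in the last equation is a default for addresses outside
  the tree.\<close>

fun left_spine_at :: "btree \<Rightarrow> vertex \<Rightarrow> nat" where
  "left_spine_at t [] = left_spine t"
| "left_spine_at (Node l r) (Lft # v) = left_spine_at l v"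
| "left_spine_at (Node l r) (Rgt # v) = left_spine_at r v"
| "left_spine_at Leaf (d # v) = 0"

definition left_path :: "vertex \<Rightarrow> nat \<Rightarrow> vertex list" where
  "left_path v k = map (\<lambda>i. v @ replicate i Lft) [0..<Suc k]"

lemma length_left_path [simp]: "length (left_path v k) = Suc k"
  by (simp add: left_path_def)

lemma left_path_neq_Nil [simp]: "left_path v k \<noteq> []"
  by (simp add: left_path_def)

lemma nth_left_path: "i \<le> k \<Longrightarrow> left_path v k ! i = v @ replicate i Lft"
  by (simp add: left_path_def del: upt_Suc)

lemma hd_left_path [simp]: "hd (left_path v k) = v"
  by (simp add: hd_conv_nth nth_left_path)

lemma left_path_snoc: "left_path v (Suc k) = left_path v k @ [v @ replicate (Suc k) Lft]"
  by (simp add: left_path_def)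

lemma left_path_Cons: "left_path v (Suc k) = v # left_path (v @ [Lft]) k"
  by (rule nth_equalityI) (auto simp: nth_left_path nth_Cons split: nat.split)

lemma Nil_in_vertices [simp]: "[] \<in> vertices t"
  by (cases t) auto

lemma vertices_prefix: "u @ v \<in> vertices t \<Longrightarrow> u \<in> vertices t"
proof (induction t arbitrary: u)
  case (Node l r)
  then show ?case by (cases u) auto
qed auto

text \<open>Descending along \<open>v\<close> reduces the claim to the root, where \<open>k\<close>
  left turns stay in the tree exactly as long as the left spine lasts.\<close>

lemma left_spine_at_iff:
  assumes "v \<in> vertices t"
  shows "v @ replicate k Lft \<in> vertices t \<longleftrightarrow> k \<le> left_spine_at t v"
  using assms
proof (induction t v arbitrary: k rule: left_spine_at.induct)
  case (1 t)
  show ?case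
  proof (induction t arbitrary: k)
    case Leaf
    show ?case by simp
  next
    case (Node l r)
    then show ?case by (cases k) auto
  qed
qed auto

text \<open>Only the last vertex has to be checked, since all others are prefixes of it and
  \<open>vertices t\<close> is closed under prefixes.\<close>

lemma L_path_left_path: "L_path t (left_path v k) \<longleftrightarrow> v @ replicate k Lft \<in> vertices t"
proof
  assume "L_path t (left_path v k)"
  then have "left_path v k ! k \<in> vertices t"
    using nth_mem[of k "left_path v k"] by (auto simp: L_path_def)
  then show "v @ replicate k Lft \<in> vertices t" by (simp add: nth_left_path)
next
  assume v: "v @ replicate k Lft \<in> vertices t"
  have "v @ replicate i Lft \<in> vertices t" if "i \<le> k" for i
  proof (rule vertices_prefix)
    show "(v @ replicate i Lft) @ replicate (k - i) Lft \<in> vertices t"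
      using v that by (simp flip: replicate_add)
  qed
  then have "set (left_path v k) \<subseteq> vertices t"
    by (auto simp: left_path_def simp del: upt_Suc)
  moreover have "left_path v k ! i = left_path v k ! (i - 1) @ [Lft]" if "1 \<le> i" "i \<le> k" for i
    using that by (cases i) (auto simp: nth_left_path replicate_append_same)
  ultimately show "L_path t (left_path v k)"
    by (auto simp: L_path_def)
qed

text \<open>Each vertex of an L-path determines the next, so first vertex and length determine the
  path.\<close>

lemma L_path_eq_left_path:
  assumes "L_path t P"
  shows "P = left_path (hd P) (length P - 1)"
proof (rule nth_equalityI)
  have ne: "P \<noteq> []" using assms by (simp add: L_path_def)
  then show "length P = length (left_path (hd P) (length P - 1))" by simp
  fix i assume "i < length P"
  then have "P ! i = hd P @ replicate i Lft"
  proof (induction i)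
    case 0
    then show ?case using ne by (simp add: hd_conv_nth)
  next
    case (Suc i)
    moreover have "P ! Suc i = P ! i @ [Lft]"
      using assms Suc.prems unfolding L_path_def by (metis diff_Suc_1 le_add1 plus_1_eq_Suc)
    ultimately show ?case by (simp add: replicate_append_same)
  qed
  with \<open>i < length P\<close> show "P ! i = left_path (hd P) (length P - 1) ! i"
    by (simp add: nth_left_path)
qed

lemma L_path_Cons_left_path:
  "L_path t (u # left_path v k) \<longleftrightarrow> v @ replicate k Lft \<in> vertices t \<and> v = u @ [Lft]"
proof
  assume L: "L_path t (u # left_path v k)"
  have "u # left_path v k = left_path u (Suc k)"
    using L_path_eq_left_path[OF L] by simp
  then have v: "left_path v k = left_path (u @ [Lft]) k"
    by (simp add: left_path_Cons)
  then have "v = u @ [Lft]" by (metis hd_left_path)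
  moreover have "L_path t (left_path u (Suc k))"
    using L \<open>u # left_path v k = _\<close> by simp
  ultimately show "v @ replicate k Lft \<in> vertices t \<and> v = u @ [Lft]"
    by (simp add: L_path_left_path)
next
  assume "v @ replicate k Lft \<in> vertices t \<and> v = u @ [Lft]"
  then show "L_path t (u # left_path v k)"
    using L_path_left_path[of t u "Suc k"] by (auto simp: left_path_Cons)
qed

lemma L_path_left_path_snoc:
  "L_path t (left_path v k @ [u]) \<longleftrightarrow>
     u = v @ replicate (Suc k) Lft \<and> v @ replicate (Suc k) Lft \<in> vertices t"
proof
  assume L: "L_path t (left_path v k @ [u])"
  have eq: "left_path v k @ [u] = left_path v (Suc k)"
    using L_path_eq_left_path[OF L] by simp
  with L show "u = v @ replicate (Suc k) Lft \<and> v @ replicate (Suc k) Lft \<in> vertices t"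
    by (metis L_path_left_path last_snoc left_path_snoc)
qed (metis L_path_left_path left_path_snoc)

text \<open>Extension upwards fails iff \<open>v\<close> is not a left child; extension downwards
  fails iff \<open>k\<close> has reached the end of the left spine.\<close>

lemma maximal_L_path_left_path:
  "maximal_L_path t (left_path v k) \<longleftrightarrow>
     v \<in> vertices t \<and> (\<nexists>u. v = u @ [Lft]) \<and> k = left_spine_at t v"
proof (cases "v \<in> vertices t")
  case True
  note spine = left_spine_at_iff[OF True]
  \<comment> \<open>Maximality quantifies over vertices of \<open>t\<close> only, so the father of a
    left child must be known to lie in \<open>t\<close>.\<close>
  have "u \<in> vertices t" if "v = u @ [Lft]" for u
    using True that vertices_prefix by blast
  then show ?thesis
    unfolding maximal_L_path_def L_path_left_path L_path_Cons_left_path L_path_left_path_snoc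
    using True spine[of k] spine[of "Suc k"] by auto
next
  case False
  then show ?thesis
    unfolding maximal_L_path_def L_path_left_path using vertices_prefix by blast
qed

lemma maximal_L_path_iff:
  "maximal_L_path t P \<longleftrightarrow>
     (\<exists>v \<in> vertices t. (\<nexists>u. v = u @ [Lft]) \<and> P = left_path v (left_spine_at t v))"
proof
  assume P: "maximal_L_path t P"
  then have "P = left_path (hd P) (length P - 1)"
    using L_path_eq_left_path by (auto simp: maximal_L_path_def)
  with P show "\<exists>v \<in> vertices t. (\<nexists>u. v = u @ [Lft]) \<and> P = left_path v (left_spine_at t v)"
    by (metis maximal_L_path_left_path)
qed (use maximal_L_path_left_path in blast)

lemma initial_vertices_eq_not_left:
  "initial_vertices t = {v \<in> vertices t. \<nexists>u. v = u @ [Lft]}"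
proof (intro equalityI subsetI)
  fix v assume "v \<in> initial_vertices t"
  then obtain P where "maximal_L_path t P" "v = hd P"
    by (auto simp: initial_vertices_def)
  then show "v \<in> {v \<in> vertices t. \<nexists>u. v = u @ [Lft]}"
    by (auto simp: maximal_L_path_iff)
next
  fix v assume "v \<in> {v \<in> vertices t. \<nexists>u. v = u @ [Lft]}"
  then have "maximal_L_path t (left_path v (left_spine_at t v))"
    by (simp add: maximal_L_path_left_path)
  then show "v \<in> initial_vertices t"
    unfolding initial_vertices_def by (intro CollectI exI conjI) simp_all
qed

lemma initial_vertices_eq:
  "initial_vertices t = {v \<in> vertices t. v = [] \<or> (\<exists>u. v = u @ [Rgt])}"
proof -
  have "(\<nexists>u. v = u @ [Lft]) \<longleftrightarrow> v = [] \<or> (\<exists>u. v = u @ [Rgt])" for v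
  proof (cases v rule: rev_cases)
    case (snoc u d)
    then show ?thesis by (cases d) auto
  qed auto
  then show ?thesis
    by (simp only: initial_vertices_eq_not_left)
qed

lemma ball_initial_vertices:
  "(\<forall>v \<in> initial_vertices t. Q v) \<longleftrightarrow> Q [] \<and> (\<forall>u. u @ [Rgt] \<in> vertices t \<longrightarrow> Q (u @ [Rgt]))"
  by (auto simp: initial_vertices_eq)

text \<open>The description in \<open>L_length\<close> is well defined because
  \<open>maximal_L_path_iff\<close> leaves a single maximal L-path starting at
  \<open>v\<close>.\<close>

lemma L_length_eq:
  assumes "v \<in> initial_vertices t"
  shows "L_length t v = left_spine_at t v"
proof -
  have "v \<in> vertices t \<and> (\<nexists>u. v = u @ [Lft])"
    using assms by (simp add: initial_vertices_eq_not_left)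
  then have max: "maximal_L_path t (left_path v (left_spine_at t v))"
    by (simp add: maximal_L_path_left_path)
  show ?thesis
    unfolding L_length_def
  proof (rule the_equality)
    show "\<exists>P. maximal_L_path t P \<and> hd P = v \<and> length P = Suc (left_spine_at t v)"
      using max by (intro exI[of _ "left_path v (left_spine_at t v)"]) simp
  qed (auto simp: maximal_L_path_iff)
qed

section \<open>Proper trees\<close>

text \<open>The spine of the root is left unconstrained: in a left subtree it is only the tail of a
  longer L-path. This makes the condition recursive.\<close>

fun proper_right :: "btree \<Rightarrow> bool" where
  "proper_right Leaf \<longleftrightarrow> True"
| "proper_right (Node l r) \<longleftrightarrow>
     proper_right l \<and> proper_right r \<and> left_spine r mod 4 \<in> {0, 1}"

definition proper_spines :: "btree \<Rightarrow> bool" where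
  "proper_spines t \<longleftrightarrow> proper_right t \<and> left_spine t mod 4 \<in> {0, 1}"

lemma all_vertices_split:
  fixes Q :: "vertex \<Rightarrow> bool"
  shows "(\<forall>u. Q u) \<longleftrightarrow> Q [] \<and> (\<forall>u. Q (Lft # u)) \<and> (\<forall>u. Q (Rgt # u))"
proof -
  have "Q u" if Q: "Q []" "\<forall>u. Q (Lft # u)" "\<forall>u. Q (Rgt # u)" for u
  proof (cases u)
    case (Cons d u')
    with Q show ?thesis by (cases d) simp_all
  qed (simp add: Q)
  then show ?thesis by blast
qed

lemma proper_right_iff:
  "proper_right t \<longleftrightarrow>
     (\<forall>u. u @ [Rgt] \<in> vertices t \<longrightarrow> left_spine_at t (u @ [Rgt]) mod 4 \<in> {0, 1})"
proof (induction t)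
  case (Node l r)
  let ?P = "\<lambda>t u. u @ [Rgt] \<in> vertices t \<longrightarrow> left_spine_at t (u @ [Rgt]) mod 4 \<in> {0, 1}"
  have "(\<forall>u. ?P (Node l r) u) \<longleftrightarrow>
      ?P (Node l r) [] \<and> (\<forall>u. ?P (Node l r) (Lft # u)) \<and> (\<forall>u. ?P (Node l r) (Rgt # u))"
    by (rule all_vertices_split)
  \<comment> \<open>The empty address contributes the right child of the root, the other two
    families the right children inside \<open>l\<close> and \<open>r\<close>.\<close>
  also have "\<dots> \<longleftrightarrow> left_spine r mod 4 \<in> {0, 1} \<and> (\<forall>u. ?P l u) \<and> (\<forall>u. ?P r u)"
    by (simp add: image_iff)
  finally show ?case
    unfolding proper_right.simps Node by argo
qed auto

lemma proper_btrees_eq_proper_spines: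
  "proper_btrees n = {t. internal t = n \<and> proper_spines t}"
proof -
  have "(\<forall>v \<in> initial_vertices t. L_length t v mod 4 \<in> {0, 1}) \<longleftrightarrow> proper_spines t" for t
  proof -
    have "(\<forall>v \<in> initial_vertices t. L_length t v mod 4 \<in> {0, 1}) \<longleftrightarrow>
        (\<forall>v \<in> initial_vertices t. left_spine_at t v mod 4 \<in> {0, 1})"
      by (rule ball_cong) (simp_all add: L_length_eq)
    also have "\<dots> \<longleftrightarrow> left_spine_at t [] mod 4 \<in> {0, 1} \<and>
        (\<forall>u. u @ [Rgt] \<in> vertices t \<longrightarrow> left_spine_at t (u @ [Rgt]) mod 4 \<in> {0, 1})"
      by (rule ball_initial_vertices)
    also have "\<dots> \<longleftrightarrow> proper_spines t"
      by (simp only: proper_spines_def proper_right_iff left_spine_at.simps conj_commute)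
    finally show ?thesis .
  qed
  then show ?thesis by (simp only: proper_btrees_eq)
qed

section \<open>The inverse of sigma\<close>

text \<open>One unit of root color corresponds to one inserted vertex, so paths can be treated one
  vertex at a time.\<close>

fun incr_color :: "qtree \<Rightarrow> qtree" where
  "incr_color (QLeaf c) = QLeaf (Suc c)"
| "incr_color (QNode c t1 t2 t3 t4 t5) = QNode (Suc c) t1 t2 t3 t4 t5"

text \<open>The last two equations concern trees that are not proper.\<close>

fun sigma_inv :: "btree \<Rightarrow> qtree" where
  "sigma_inv Leaf = QLeaf 0"
| "sigma_inv (Node Leaf r) = incr_color (sigma_inv r)"
| "sigma_inv (Node (Node (Node (Node t1 t2) t3) t4) t5) =
     QNode 0 (sigma_inv t1) (sigma_inv t2) (sigma_inv t3) (sigma_inv t4) (sigma_inv t5)"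
| "sigma_inv (Node (Node Leaf t4) t5) = QLeaf 0"
| "sigma_inv (Node (Node (Node Leaf t3) t4) t5) = QLeaf 0"

lemma q_internal_incr_color [simp]: "q_internal (incr_color T) = q_internal T"
  by (cases T) auto

lemma color_sum_incr_color [simp]: "color_sum (incr_color T) = Suc (color_sum T)"
  by (cases T) auto

text \<open>Every colored tree arises from roots of color \<open>0\<close> by raising root colors,
  which matches the cases that \<open>sigma_inv\<close> distinguishes.\<close>

lemma qtree_color_induct [case_names QLeaf QNode incr_color]:
  assumes "P (QLeaf 0)"
    and node: "\<And>t1 t2 t3 t4 t5. P t1 \<Longrightarrow> P t2 \<Longrightarrow> P t3 \<Longrightarrow> P t4 \<Longrightarrow> P t5 \<Longrightarrow> P (QNode 0 t1 t2 t3 t4 t5)"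
    and incr: "\<And>t. P t \<Longrightarrow> P (incr_color t)"
  shows "P T"
proof (induction T)
  case (QLeaf c)
  show ?case
    by (induction c) (use assms(1) incr[of "QLeaf _"] in auto)
next
  case (QNode c t1 t2 t3 t4 t5)
  then show ?case
    by (induction c) (use node incr[of "QNode _ t1 t2 t3 t4 t5"] in auto)
qed

lemma sigma_QLeaf_0 [simp]: "sigma (QLeaf 0) = Leaf"
  by (simp add: sigma_def insert_path_def)

lemma sigma_QNode_0 [simp]:
  "sigma (QNode 0 t1 t2 t3 t4 t5) =
     Node (Node (Node (Node (sigma t1) (sigma t2)) (sigma t3)) (sigma t4)) (sigma t5)"
  by (simp add: sigma_def insert_path_def)

lemma sigma_incr_color [simp]: "sigma (incr_color T) = Node Leaf (sigma T)"
  by (cases T) (simp_all add: sigma_def insert_path_def)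

lemma sigma_inv_sigma: "sigma_inv (sigma T) = T"
  by (induction T rule: qtree_color_induct) auto

lemma proper_spines_sigma: "proper_spines (sigma T)"
  by (induction T rule: qtree_color_induct) (auto simp: proper_spines_def)

text \<open>The two default cases of \<open>sigma_inv\<close> have left spines of length 2 and 3,
  excluded by properness. In the others, the subtrees recursed on are proper: they hang from right
  edges, except \<open>t1\<close>, whose left spine is shorter by 4.\<close>

lemma sigma_sigma_inv: "proper_spines t \<Longrightarrow> sigma (sigma_inv t) = t"
  by (induction t rule: sigma_inv.induct) (auto simp: proper_spines_def)

text \<open>A vertex with five children becomes four binary ones, and each unit of color adds
  one.\<close>

lemma internal_sigma: "internal (sigma T) = 4 * q_internal T + color_sum T"
  by (induction T rule: qtree_color_induct) auto

text \<open>The bound \<open>p \<le> n div 4\<close> keeps the subtraction \<open>n - 4 * p\<close>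
  from truncating.\<close>

lemma colored_qtrees_eq: "colored_qtrees n = {T. 4 * q_internal T + color_sum T = n}"
  by (auto simp: colored_qtrees_def colored_qtrees_with_def)

theorem theorem2:
  fixes n :: nat
  shows "bij_betw sigma (colored_qtrees n) (proper_btrees n)"
  unfolding colored_qtrees_eq proper_btrees_eq_proper_spines
proof (rule bij_betw_byWitness[where f' = sigma_inv])
  show "sigma_inv ` {t. internal t = n \<and> proper_spines t}
      \<subseteq> {T. 4 * q_internal T + color_sum T = n}"
    \<comment> \<open>Read backwards, \<open>internal_sigma\<close> turns the weight of
      \<open>sigma_inv t\<close> into \<open>internal (sigma (sigma_inv t))\<close>, which is
      \<open>internal t\<close>.\<close>
    by (auto simp: sigma_sigma_inv simp flip: internal_sigma)
qed (auto simp: sigma_inv_sigma sigma_sigma_inv internal_sigma proper_spines_sigma)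

end
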